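(* There exists a binary linear code of length $108$, dimension $29$ and minimum distance $32$. *)

theory Defs
  imports Main
begin

text \<open>Binary words of length n are lists of booleans (False = 0, True = 1) of length n.
  Addition over GF(2) is componentwise exclusive or.\<close>

definition bw_add :: "bool list \<Rightarrow> bool list \<Rightarrow> bool list" where
  "bw_add x y = map2 (\<noteq>) x y"

definition bw_zero :: "nat \<Rightarrow> bool list" where
  "bw_zero n = replicate n False"

definition hamming_weight :: "bool list \<Rightarrow> nat" where
  "hamming_weight x = length (filter id x)"

definition hamming_dist :: "bool list \<Rightarrow> bool list \<Rightarrow> nat" where
  "hamming_dist x y = length (filter id (map2 (\<noteq>) x y))"

fun lin_comb :: "nat \<Rightarrow> bool list \<Rightarrow> bool list list \<Rightarrow> bool list" where
  "lin_comb n [] _ = bw_zero n"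
| "lin_comb n _ [] = bw_zero n"
| "lin_comb n (c # cs) (v # vs) =
     (if c then bw_add v (lin_comb n cs vs) else lin_comb n cs vs)"

definition binary_linear_code :: "nat \<Rightarrow> bool list set \<Rightarrow> bool" where
  "binary_linear_code n C \<longleftrightarrow>
     C \<subseteq> {x. length x = n} \<and> bw_zero n \<in> C \<and>
     (\<forall>x\<in>C. \<forall>y\<in>C. bw_add x y \<in> C)"

definition code_dim :: "nat \<Rightarrow> bool list set \<Rightarrow> nat \<Rightarrow> bool" where
  "code_dim n C k \<longleftrightarrow>
     (\<exists>B. length B = k \<and> set B \<subseteq> C \<and>
        (\<forall>x\<in>C. \<exists>!cs. length cs = k \<and> lin_comb n cs B = x))"

definition min_distance :: "bool list set \<Rightarrow> nat \<Rightarrow> bool" where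
  "min_distance C d \<longleftrightarrow>
     (\<exists>x\<in>C. \<exists>y\<in>C. x \<noteq> y \<and> hamming_dist x y = d) \<and>
     (\<forall>x\<in>C. \<forall>y\<in>C. x \<noteq> y \<longrightarrow> d \<le> hamming_dist x y)"

end

(* The code consists of words (a | a + b) of two halves of length 54, where b runs through a
   12-dimensional space and, for given b, a runs through a coset of a 17-dimensional code A.
   Such a word has weight wt(b) + 2 wt(a off the support of b).  If b = 0 it has the form (a | a)
   with a in A, and if wt(b) >= 32 nothing remains to be shown; for each other b one checks that
   no word of the coset of A, restricted to the complement of the support of b, has weight below
   (32 - wt(b)) / 2, by a search that fixes the coordinates one after the other and spends a small
   budget of ones.  A is itself built in the same way from halves of length 27.

   The generator rows come from a computer search: up to a permutation of coordinates the code is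
   invariant under a regular action of the group (Z9 semidirect Z3) x Z4, and the
   decomposition above is that by the central involution. *)
theory Submission
  imports Defs
begin

section \<open>Addition of binary words and Hamming weight\<close>

lemma bw_add_Nil [simp, code]: "bw_add [] y = []" "bw_add x [] = []"
  by (simp_all add: bw_add_def)

lemma bw_add_Cons [simp]: "bw_add (a # x) (b # y) = (a \<noteq> b) # bw_add x y"
  by (simp add: bw_add_def)

text \<open>Code equations by matching on the leading bits, so that evaluation adds words without
  passing through \<open>zip\<close> and a connective on booleans.\<close>

lemma bw_add_Cons_code [code]:
  "bw_add (True # x) (True # y) = False # bw_add x y"
  "bw_add (True # x) (False # y) = True # bw_add x y"
  "bw_add (False # x) (b # y) = b # bw_add x y"
  by simp_all

lemma length_bw_add [simp]: "length (bw_add x y) = min (length x) (length y)"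
  by (simp add: bw_add_def)

lemma bw_add_commute: "bw_add x y = bw_add y x"
  by (induction x y rule: list_induct2') auto

lemma bw_add_assoc: "bw_add (bw_add x y) z = bw_add x (bw_add y z)"
proof (induction x arbitrary: y z)
  case (Cons a x)
  then show ?case by (cases y; cases z) auto
qed simp

lemma bw_add_left_commute: "bw_add x (bw_add y z) = bw_add y (bw_add x z)"
  by (metis bw_add_assoc bw_add_commute)

lemmas bw_add_ac = bw_add_assoc bw_add_commute bw_add_left_commute

lemma bw_zero_simps [simp]: "bw_zero 0 = []" "bw_zero (Suc n) = False # bw_zero n"
  by (simp_all add: bw_zero_def)

lemma length_bw_zero [simp]: "length (bw_zero n) = n"
  by (simp add: bw_zero_def)

lemma bw_add_zero_left [simp]: "length x \<le> n \<Longrightarrow> bw_add (bw_zero n) x = x"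
proof (induction x arbitrary: n)
  case (Cons a x)
  then show ?case by (cases n) auto
qed simp

lemma bw_add_zero_right [simp]: "length x \<le> n \<Longrightarrow> bw_add x (bw_zero n) = x"
  by (metis bw_add_zero_left bw_add_commute)

lemma bw_add_self: "bw_add x x = bw_zero (length x)"
  by (induction x) auto

lemma bw_add_cancel: "length z \<le> length x \<Longrightarrow> bw_add x (bw_add x z) = z"
  by (metis bw_add_assoc bw_add_self bw_add_zero_left)

lemma bw_add_append:
  "length x = length x' \<Longrightarrow> bw_add (x @ y) (x' @ y') = bw_add x x' @ bw_add y y'"
  by (simp add: bw_add_def)

lemma bw_add_rev: "length x = length y \<Longrightarrow> bw_add (rev x) (rev y) = rev (bw_add x y)"
  by (induction x y rule: list_induct2) (auto simp: bw_add_append)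

lemma bw_zero_add: "bw_zero (m + n) = bw_zero m @ bw_zero n"
  by (simp add: bw_zero_def replicate_add)

lemma rev_bw_zero: "rev (bw_zero n) = bw_zero n"
  by (simp add: bw_zero_def)

lemma hamming_weight_Nil [simp]: "hamming_weight [] = 0"
  by (simp add: hamming_weight_def)

lemma hamming_weight_Cons [simp]:
  "hamming_weight (a # x) = (if a then Suc (hamming_weight x) else hamming_weight x)"
  by (simp add: hamming_weight_def)

lemma hamming_weight_append: "hamming_weight (x @ y) = hamming_weight x + hamming_weight y"
  by (simp add: hamming_weight_def)

lemma hamming_weight_rev: "hamming_weight (rev x) = hamming_weight x"
  by (simp add: hamming_weight_def flip: rev_filter)

lemma hamming_weight_zero [simp]: "hamming_weight (bw_zero n) = 0"
  by (induction n) auto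

lemma hamming_dist_eq: "hamming_dist x y = hamming_weight (bw_add x y)"
  by (simp add: hamming_dist_def hamming_weight_def bw_add_def)

section \<open>Linear combinations and spans\<close>

lemma length_lin_comb [simp]:
  "\<forall>r\<in>set rs. length r = n \<Longrightarrow> length (lin_comb n cs rs) = n"
  by (induction n cs rs rule: lin_comb.induct) auto

lemma lin_comb_add:
  "\<lbrakk>length cs = length rs; length ds = length rs; \<forall>r\<in>set rs. length r = n\<rbrakk> \<Longrightarrow>
    lin_comb n (bw_add cs ds) rs = bw_add (lin_comb n cs rs) (lin_comb n ds rs)"
proof (induction rs arbitrary: cs ds)
  case (Cons r rs)
  obtain c cs' d ds' where eq: "cs = c # cs'" "ds = d # ds'"
    using Cons.prems by (metis length_Suc_conv)
  have IH: "lin_comb n (bw_add cs' ds') rs = bw_add (lin_comb n cs' rs) (lin_comb n ds' rs)"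
    using Cons eq by simp
  define u v where "u = lin_comb n cs' rs" and "v = lin_comb n ds' rs"
  \<comment> \<open>If both leading coefficients are one, the two copies of \<open>r\<close>
    cancel.\<close>
  have "bw_add (bw_add r u) (bw_add r v) = bw_add u v"
  proof -
    have "bw_add (bw_add r u) (bw_add r v) = bw_add r (bw_add r (bw_add u v))"
      by (simp only: bw_add_ac)
    then show ?thesis
      using Cons.prems by (simp add: bw_add_cancel u_def v_def)
  qed
  moreover have "bw_add u (bw_add r v) = bw_add r (bw_add u v)"
    by (rule bw_add_left_commute)
  ultimately show ?case
    by (simp add: eq IH bw_add_assoc flip: u_def v_def)
qed auto

lemma lin_comb_zero: "True \<notin> set cs \<Longrightarrow> lin_comb n cs rs = bw_zero n"
  by (induction n cs rs rule: lin_comb.induct) auto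

lemma lin_comb_append:
  "\<lbrakk>length cs = length rs; \<forall>r\<in>set rs. length r = n; \<forall>r\<in>set rs'. length r = n\<rbrakk> \<Longrightarrow>
    lin_comb n (cs @ ds) (rs @ rs') = bw_add (lin_comb n cs rs) (lin_comb n ds rs')"
proof (induction cs rs rule: list_induct2)
  case Nil
  then show ?case by simp
qed (auto simp: bw_add_assoc)

text \<open>The recursion follows that of \<open>echelon\<close>, so that the two can be compared by
  adding one row at a time; \<open>span_eq_lin_comb\<close> gives the link to coefficient
  vectors.\<close>

fun span :: "nat \<Rightarrow> bool list list \<Rightarrow> bool list set" where
  "span n [] = {bw_zero n}"
| "span n (r # rs) = span n rs \<union> bw_add r ` span n rs"

lemma lin_comb_in_span: "length cs = length rs \<Longrightarrow> lin_comb n cs rs \<in> span n rs"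
  by (induction cs rs rule: list_induct2) auto

lemma span_eq_lin_comb: "span n rs = {lin_comb n cs rs | cs. length cs = length rs}"
proof -
  have "\<exists>cs. length cs = length rs \<and> x = lin_comb n cs rs" if "x \<in> span n rs" for x
    using that
  proof (induction rs arbitrary: x)
    case (Cons r rs)
    then consider (skip) "x \<in> span n rs" | (add) z where "z \<in> span n rs" "x = bw_add r z"
      by auto
    then show ?case
    proof cases
      case skip
      then obtain cs where "length cs = length rs" "x = lin_comb n cs rs"
        using Cons.IH by blast
      then show ?thesis
        by (intro exI [of _ "False # cs"]) simp
    next
      case add
      then obtain cs where "length cs = length rs" "z = lin_comb n cs rs"
        using Cons.IH by blast
      with add show ?thesis
        by (intro exI [of _ "True # cs"]) simp
    qed
  qed simp
  then show ?thesis
    using lin_comb_in_span by blast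
qed

lemma length_span: "\<lbrakk>w \<in> span n rs; \<forall>r\<in>set rs. length r = n\<rbrakk> \<Longrightarrow> length w = n"
  by (induction rs arbitrary: w) auto

text \<open>Lets a search for light words start from the last coordinate.\<close>

lemma span_rev:
  "\<lbrakk>w \<in> span n rs; \<forall>r\<in>set rs. length r = n\<rbrakk> \<Longrightarrow> rev w \<in> span n (map rev rs)"
proof (induction rs arbitrary: w)
  case (Cons r rs)
  show ?case
  proof (cases "w \<in> span n rs")
    case False
    then obtain z where z: "z \<in> span n rs" "w = bw_add r z"
      using Cons.prems by auto
    then have "length r = length z"
      using Cons.prems length_span [of z n rs] by simp
    then have "rev w = bw_add (rev r) (rev z)"
      by (simp add: z bw_add_rev)
    then show ?thesis
      using Cons z by auto
  qed (use Cons in auto)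
qed (simp add: rev_bw_zero)

section \<open>Minimum weight and the parameters of a code\<close>

text \<open>Ranging over nonzero coefficient vectors rather than nonzero words makes this include,
  for \<open>0 < d\<close>, the linear independence of the rows.\<close>

definition min_weight :: "nat \<Rightarrow> nat \<Rightarrow> bool list list \<Rightarrow> bool" where
  "min_weight n d rs \<longleftrightarrow>
    (\<forall>cs. length cs = length rs \<and> True \<in> set cs \<longrightarrow> d \<le> hamming_weight (lin_comb n cs rs))"

text \<open>Distinct coefficient vectors of the same word have a nonzero sum, whose combination is
  the zero word, of weight less than \<open>d\<close>.\<close>

lemma lin_comb_inj:
  assumes "min_weight n d rs" "0 < d" "\<forall>r\<in>set rs. length r = n"
    and "length cs = length rs" "length ds = length rs"
    and eq: "lin_comb n cs rs = lin_comb n ds rs"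
  shows "cs = ds"
proof (rule ccontr)
  assume "cs \<noteq> ds"
  have "length cs = length ds"
    using assms(4,5) by simp
  then have "True \<in> set (bw_add cs ds)"
    using \<open>cs \<noteq> ds\<close> by (induction cs ds rule: list_induct2) auto
  then have "d \<le> hamming_weight (lin_comb n (bw_add cs ds) rs)"
    using assms(1,4,5) unfolding min_weight_def by simp
  also have "lin_comb n (bw_add cs ds) rs = bw_add (lin_comb n ds rs) (lin_comb n ds rs)"
    using lin_comb_add [OF assms(4,5,3)] eq by simp
  finally show False
    using assms(2) by (simp only: bw_add_self hamming_weight_zero)
qed

lemma span_add:
  assumes "\<forall>r\<in>set rs. length r = n" "x \<in> span n rs" "y \<in> span n rs"
  shows "bw_add x y \<in> span n rs"
proof -
  obtain cs ds where x: "x = lin_comb n cs rs" "length cs = length rs"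
    and y: "y = lin_comb n ds rs" "length ds = length rs"
    using assms(2,3) unfolding span_eq_lin_comb by blast
  have "bw_add x y = lin_comb n (bw_add cs ds) rs"
    unfolding x(1) y(1) using lin_comb_add [OF x(2) y(2) assms(1)] by simp
  moreover have "length (bw_add cs ds) = length rs"
    using x(2) y(2) by simp
  ultimately show ?thesis
    using lin_comb_in_span by metis
qed

lemma zero_in_span: "bw_zero n \<in> span n rs"
  by (induction rs) auto

lemma span_binary_linear_code:
  assumes "\<forall>r\<in>set rs. length r = n"
  shows "binary_linear_code n (span n rs)"
  unfolding binary_linear_code_def
  using assms length_span span_add zero_in_span by blast

lemma set_subset_span:
  "\<forall>r\<in>set rs. length r = n \<Longrightarrow> set rs \<subseteq> span n rs"
proof (induction rs)
  case (Cons r rs)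
  have "r \<in> bw_add r ` span n rs"
    using Cons.prems zero_in_span by (intro image_eqI [of _ _ "bw_zero n"]) auto
  then show ?case
    using Cons by auto
qed simp

lemma span_code_dim:
  assumes "min_weight n d rs" "0 < d" "\<forall>r\<in>set rs. length r = n"
  shows "code_dim n (span n rs) (length rs)"
  unfolding code_dim_def
proof (intro exI [of _ rs] conjI ballI)
  fix x assume "x \<in> span n rs"
  then obtain cs where "length cs = length rs" "lin_comb n cs rs = x"
    unfolding span_eq_lin_comb by blast
  then show "\<exists>!cs. length cs = length rs \<and> lin_comb n cs rs = x"
    using lin_comb_inj [OF assms] by blast
qed (use set_subset_span [OF assms(3)] in auto)

text \<open>The distance of two words is the weight of their sum, which lies in the span again; the
  distance \<open>d\<close> is attained by \<open>x\<close> and the zero word.\<close>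

lemma span_min_distance:
  assumes "min_weight n d rs" "0 < d" "\<forall>r\<in>set rs. length r = n"
    and "x \<in> span n rs" "hamming_weight x = d"
  shows "min_distance (span n rs) d"
  unfolding min_distance_def
proof (intro conjI ballI impI)
  have "length x = n"
    using assms length_span by blast
  then have "hamming_dist x (bw_zero n) = d"
    using assms(5) by (simp add: hamming_dist_eq)
  moreover have "x \<noteq> bw_zero n"
    using assms(2,5) by auto
  ultimately show "\<exists>x\<in>span n rs. \<exists>y\<in>span n rs. x \<noteq> y \<and> hamming_dist x y = d"
    using assms(4) zero_in_span by blast
next
  fix x y assume x: "x \<in> span n rs" and y: "y \<in> span n rs" and "x \<noteq> y"
  have len: "length x = n" "length y = n"
    using x y assms(3) length_span by blast+
  have "bw_add x y \<noteq> bw_zero n"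
  proof
    assume "bw_add x y = bw_zero n"
    then have "bw_add x (bw_zero n) = y"
      using bw_add_cancel [of y x] len by simp
    then show False
      using \<open>x \<noteq> y\<close> len by simp
  qed
  moreover obtain cs where cs: "bw_add x y = lin_comb n cs rs" "length cs = length rs"
    using span_add [OF assms(3) x y] unfolding span_eq_lin_comb by blast
  ultimately have "True \<in> set cs"
    using lin_comb_zero by metis
  with cs show "d \<le> hamming_dist x y"
    using assms(1) by (simp add: min_weight_def hamming_dist_eq)
qed

section \<open>Row echelon forms\<close>

text \<open>An entry \<open>Some p\<close> at position \<open>i\<close> stands for a row that vanishes before \<open>i\<close>, has a one
  at \<open>i\<close>, and continues with \<open>p\<close>.\<close>

type_synonym row_echelon = "bool list option list"

fun echelon_span :: "row_echelon \<Rightarrow> bool list set" where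
  "echelon_span [] = {[]}"
| "echelon_span (None # ps) = (#) False ` echelon_span ps"
| "echelon_span (Some p # ps) =
    (#) False ` echelon_span ps \<union> (\<lambda>w. True # bw_add p w) ` echelon_span ps"

text \<open>Gaussian elimination: the row is reduced by the pivot rows that it meets and is stored
  at its first one in a free position. A dependent row reduces to zero and changes nothing; such
  rows can arise when coordinates are deleted.\<close>

fun insert_row :: "row_echelon \<Rightarrow> bool list \<Rightarrow> row_echelon" where
  "insert_row (None # ps) (False # r) = None # insert_row ps r"
| "insert_row (None # ps) (True # r) = Some r # ps"
| "insert_row (Some p # ps) (False # r) = Some p # insert_row ps r"
| "insert_row (Some p # ps) (True # r) = Some p # insert_row ps (bw_add r p)"
| "insert_row ps _ = ps"

text \<open>The word \<open>v\<close> only supplies the length, so that no numeral has to be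
  evaluated.\<close>

fun echelon :: "bool list \<Rightarrow> bool list list \<Rightarrow> row_echelon" where
  "echelon v [] = map (\<lambda>_. None) v"
| "echelon v (r # rs) = insert_row (echelon v rs) r"

fun wf_echelon :: "row_echelon \<Rightarrow> bool" where
  "wf_echelon [] \<longleftrightarrow> True"
| "wf_echelon (None # ps) \<longleftrightarrow> wf_echelon ps"
| "wf_echelon (Some p # ps) \<longleftrightarrow> length p = length ps \<and> wf_echelon ps"

lemma length_echelon_span: "\<lbrakk>w \<in> echelon_span ps; wf_echelon ps\<rbrakk> \<Longrightarrow> length w = length ps"
  by (induction ps arbitrary: w rule: wf_echelon.induct) auto

lemma insert_row_wf:
  "\<lbrakk>wf_echelon ps; length r = length ps\<rbrakk> \<Longrightarrow>
    wf_echelon (insert_row ps r) \<and> length (insert_row ps r) = length ps"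
  by (induction ps r rule: insert_row.induct) auto

text \<open>The two conclusions match the two parts of the union in
  \<open>span n (r # rs)\<close>.\<close>

lemma insert_row_span:
  "\<lbrakk>wf_echelon ps; length r = length ps; w \<in> echelon_span ps\<rbrakk> \<Longrightarrow>
    w \<in> echelon_span (insert_row ps r) \<and> bw_add r w \<in> echelon_span (insert_row ps r)"
proof (induction ps r arbitrary: w rule: insert_row.induct)
  case (3 p ps r)
  then show ?case by (auto simp: bw_add_left_commute [of r p])
next
  case (4 p ps r)
  \<comment> \<open>Adding the pivot row \<open>p\<close> once more undoes the reduction of
    \<open>r\<close> by \<open>p\<close>.\<close>
  have cancel: "bw_add p (bw_add (bw_add r p) z) = bw_add r z" if "z \<in> echelon_span ps" for z
  proof -
    have "bw_add p (bw_add (bw_add r p) z) = bw_add (bw_add p p) (bw_add r z)"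
      by (simp add: bw_add_ac)
    then show ?thesis
      using 4 that by (simp add: bw_add_self length_echelon_span)
  qed
  have IH: "z \<in> echelon_span (insert_row ps (bw_add r p))
      \<and> bw_add (bw_add r p) z \<in> echelon_span (insert_row ps (bw_add r p))"
    if "z \<in> echelon_span ps" for z
    using 4 that by simp
  obtain z where z: "z \<in> echelon_span ps" "w = False # z \<or> w = True # bw_add p z"
    using 4 by auto
  have "bw_add r z \<in> bw_add p ` echelon_span (insert_row ps (bw_add r p))"
    using IH [OF z(1)] cancel [OF z(1)] by (metis image_eqI)
  then show ?case
    using z IH [OF z(1)] by (auto simp: bw_add_assoc)
qed auto

text \<open>This inclusion suffices: a lower bound on weights for all words of the echelon span
  carries over to the span.\<close>

lemma span_subset_echelon:
  assumes "\<forall>r\<in>set rs. length r = length v"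
  shows "span (length v) rs \<subseteq> echelon_span (echelon v rs)
    \<and> wf_echelon (echelon v rs) \<and> length (echelon v rs) = length v"
  using assms
proof (induction rs)
  case Nil
  show ?case by (induction v) auto
next
  case (Cons r rs)
  then show ?case
    using insert_row_wf [of "echelon v rs" r] insert_row_span [of "echelon v rs" r] by auto
qed

section \<open>Search for light words in a coset\<close>

text \<open>The budget \<open>e\<close> is the number of ones still allowed. At \<open>None\<close>
  the bit of \<open>v\<close> is forced; at \<open>Some p\<close> both values are tried, and a one
  costs one unit. A branch closes when a forced one exceeds the budget. Reaching the end means that
  a word of weight at most the initial budget exists, hence \<open>False\<close>.\<close>

fun heavy :: "row_echelon \<Rightarrow> bool list \<Rightarrow> nat \<Rightarrow> bool" where
  "heavy (None # ps) (False # v) e = heavy ps v e"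
| "heavy (None # ps) (True # v) (Suc e) = heavy ps v e"
| "heavy (None # ps) (True # v) 0 = True"
| "heavy (Some p # ps) (False # v) 0 = heavy ps v 0"
| "heavy (Some p # ps) (True # v) 0 = heavy ps (bw_add v p) 0"
| "heavy (Some p # ps) (False # v) (Suc e) =
    (if heavy ps v (Suc e) then heavy ps (bw_add v p) e else False)"
| "heavy (Some p # ps) (True # v) (Suc e) =
    (if heavy ps v e then heavy ps (bw_add v p) (Suc e) else False)"
| "heavy _ _ _ = False"

text \<open>At most \<open>e\<close> ones may be spent on the first \<open>h\<close> coordinates;
  then \<open>k\<close> is added to what remains of the budget and the plain search takes
  over.\<close>

fun heavy_prefix :: "nat \<Rightarrow> row_echelon \<Rightarrow> bool list \<Rightarrow> nat \<Rightarrow> nat \<Rightarrow> bool" where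
  "heavy_prefix 0 ps v e k = heavy ps v (e + k)"
| "heavy_prefix (Suc h) (None # ps) (False # v) e k = heavy_prefix h ps v e k"
| "heavy_prefix (Suc h) (None # ps) (True # v) (Suc e) k = heavy_prefix h ps v e k"
| "heavy_prefix (Suc h) (None # ps) (True # v) 0 k = True"
| "heavy_prefix (Suc h) (Some p # ps) (False # v) 0 k = heavy_prefix h ps v 0 k"
| "heavy_prefix (Suc h) (Some p # ps) (True # v) 0 k = heavy_prefix h ps (bw_add v p) 0 k"
| "heavy_prefix (Suc h) (Some p # ps) (False # v) (Suc e) k =
    (if heavy_prefix h ps v (Suc e) k then heavy_prefix h ps (bw_add v p) e k else False)"
| "heavy_prefix (Suc h) (Some p # ps) (True # v) (Suc e) k =
    (if heavy_prefix h ps v e k then heavy_prefix h ps (bw_add v p) (Suc e) k else False)"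
| "heavy_prefix _ _ _ _ _ = False"

lemma heavy_sound:
  "\<lbrakk>heavy ps v e; w \<in> echelon_span ps\<rbrakk> \<Longrightarrow> e < hamming_weight (bw_add v w)"
  by (induction ps v e arbitrary: w rule: heavy.induct)
    (force simp: bw_add_assoc split: if_splits)+

lemma heavy_prefix_sound:
  "\<lbrakk>heavy_prefix h ps v e k; w \<in> echelon_span ps\<rbrakk> \<Longrightarrow>
    e < hamming_weight (take h (bw_add v w)) \<or> e + k < hamming_weight (bw_add v w)"
  by (induction h ps v e k arbitrary: w rule: heavy_prefix.induct)
    (force simp: bw_add_assoc heavy_sound split: if_splits)+

text \<open>Recursion in place of \<open>div\<close>, \<open>length\<close> and subtraction, here and in \<open>deficit\<close> below,
  keeps all budgets in unary form during evaluation by rewriting.\<close>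

fun half :: "nat \<Rightarrow> nat" where
  "half (Suc (Suc n)) = Suc (half n)"
| "half (Suc 0) = 0"
| "half 0 = 0"

lemma half_eq: "half n = n div 2"
  by (induction n rule: half.induct) auto

fun half_length :: "'a list \<Rightarrow> nat" where
  "half_length (x # y # xs) = Suc (half_length xs)"
| "half_length [x] = 0"
| "half_length [] = 0"

lemma half_length_eq: "half_length xs = length xs div 2"
  by (induction xs rule: half_length.induct) auto

text \<open>The budgets \<open>half e\<close> and \<open>half (Suc e)\<close> add up to
  \<open>e\<close>. The extra \<open>False\<close> rounds the half length up, so that the reversed
  search covers exactly the coordinates outside the first half.\<close>

definition heavy_coset :: "bool list \<Rightarrow> bool list list \<Rightarrow> nat \<Rightarrow> bool" where
  "heavy_coset v rs e =
    (if heavy_prefix (half_length v) (echelon v rs) v (half e) (half (Suc e))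
     then heavy_prefix (half_length (False # v)) (echelon v (map rev rs)) (rev v)
       (half e) (half (Suc e))
     else False)"

text \<open>A word of weight at most \<open>e\<close> has weight at most \<open>e div 2\<close> on its first or on its second
  half, so it is met by one of two searches with half the budget on the leading coordinates.\<close>

lemma heavy_coset_sound:
  assumes "heavy_coset v rs e" "\<forall>r\<in>set rs. length r = length v" "w \<in> span (length v) rs"
  shows "e < hamming_weight (bw_add v w)"
proof (rule ccontr)
  define u where "u = bw_add v w"
  define h where "h = length v div 2"
  assume "\<not> e < hamming_weight (bw_add v w)"
  then have light: "hamming_weight u \<le> e"
    by (simp add: u_def)
  have len: "length w = length v"
    using assms(2,3) length_span by blast
  then have len_u: "length u = length v"
    by (simp add: u_def)
  have h': "half_length (False # v) = length v - h"
    unfolding half_length_eq h_def by simp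
  have halves: "half e + half (Suc e) = e"
    unfolding half_eq by linarith
  have "heavy_prefix h (echelon v rs) v (half e) (half (Suc e))"
    using assms(1) by (simp add: heavy_coset_def h_def half_length_eq split: if_splits)
  moreover have "w \<in> echelon_span (echelon v rs)"
    using span_subset_echelon [OF assms(2)] assms(3) by blast
  ultimately have "half e < hamming_weight (take h u) \<or>
      half e + half (Suc e) < hamming_weight u"
    unfolding u_def by (rule heavy_prefix_sound)
  then have 1: "half e < hamming_weight (take h u)"
    using light halves by simp
  have "rev w \<in> span (length (rev v)) (map rev rs)"
    using span_rev [OF assms(3,2)] by simp
  then have "rev w \<in> echelon_span (echelon v (map rev rs))"
    using span_subset_echelon [of "map rev rs" v] assms(2) by auto
  moreover have "heavy_prefix (length v - h) (echelon v (map rev rs)) (rev v) (half e) (half (Suc e))"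
    using assms(1) unfolding heavy_coset_def h' by (simp split: if_splits)
  moreover have "bw_add (rev v) (rev w) = rev u"
    using len by (simp add: u_def bw_add_rev)
  ultimately have "half e < hamming_weight (take (length v - h) (rev u)) \<or>
      half e + half (Suc e) < hamming_weight (rev u)"
    using heavy_prefix_sound by metis
  then have "half e < hamming_weight (take (length v - h) (rev u))"
    using light halves by (simp add: hamming_weight_rev)
  \<comment> \<open>The leading part of the reversed word is the second half of
    \<open>u\<close>.\<close>
  moreover have "take (length v - h) (rev u) = rev (drop h u)"
    using len_u by (simp add: take_rev h_def)
  moreover have "hamming_weight u = hamming_weight (take h u) + hamming_weight (drop h u)"
    by (simp flip: hamming_weight_append)
  \<comment> \<open>Each half has at least \<open>e div 2 + 1\<close> ones, together more than
    \<open>e\<close>.\<close>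
  ultimately show False
    using 1 light by (simp add: hamming_weight_rev half_eq)
qed

text \<open>A nonzero combination is sorted by the first row \<open>r\<close> occurring in it; it
  then lies in the coset of \<open>r\<close> modulo the span of the later rows.\<close>

fun heavy_code :: "nat \<Rightarrow> bool list list \<Rightarrow> bool" where
  "heavy_code e [] = True"
| "heavy_code e (r # rs) = (if heavy_coset r rs e then heavy_code e rs else False)"

lemma heavy_code_sound:
  assumes "heavy_code e rs" "\<forall>r\<in>set rs. length r = n"
  shows "min_weight n (Suc e) rs"
  using assms
proof (induction rs)
  case (Cons r rs)
  show ?case
    unfolding min_weight_def
  proof (intro allI impI, elim conjE)
    fix cs assume cs: "length cs = length (r # rs)" "True \<in> set cs"
    then obtain c cs' where cs': "cs = c # cs'" "length cs' = length rs"
      by (cases cs) auto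
    show "Suc e \<le> hamming_weight (lin_comb n cs (r # rs))"
    proof (cases c)
      case True
      then show ?thesis
        using cs' Cons.prems heavy_coset_sound [of r rs e "lin_comb n cs' rs"]
          lin_comb_in_span [of cs' rs n]
        by (auto simp: Suc_le_eq split: if_splits)
    next
      case False
      then show ?thesis
        using cs cs' Cons by (auto simp: min_weight_def split: if_splits)
    qed
  qed
qed (simp add: min_weight_def)

section \<open>Words of the form (u | u + v)\<close>

fun off_support :: "bool list \<Rightarrow> bool list \<Rightarrow> bool list" where
  "off_support (True # b) (x # r) = off_support b r"
| "off_support (False # b) (x # r) = x # off_support b r"
| "off_support [] r = []"
| "off_support b [] = []"

text \<open>Here \<open>length (off_support b b)\<close> serves as an expression for the number of
  zeros of \<open>b\<close>.\<close>

lemma length_off_support: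
  "length r = length b \<Longrightarrow> length (off_support b r) = length (off_support b b)"
  by (induction b r rule: off_support.induct) auto

lemma off_support_add:
  "\<lbrakk>length x = length b; length y = length b\<rbrakk> \<Longrightarrow>
    off_support b (bw_add x y) = bw_add (off_support b x) (off_support b y)"
proof (induction b arbitrary: x y)
  case (Cons c b)
  then show ?case by (cases x; cases y; cases c) auto
qed simp

lemma off_support_zero: "off_support b (bw_zero (length b)) = bw_zero (length (off_support b b))"
proof (induction b)
  case (Cons c b)
  then show ?case by (cases c) auto
qed simp

lemma off_support_span:
  "\<lbrakk>w \<in> span (length b) rs; \<forall>r\<in>set rs. length r = length b\<rbrakk> \<Longrightarrow>
    off_support b w \<in> span (length (off_support b b)) (map (off_support b) rs)"
proof (induction rs arbitrary: w)
  case (Cons r rs)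
  show ?case
  proof (cases "w \<in> span (length b) rs")
    case False
    then obtain z where z: "z \<in> span (length b) rs" "w = bw_add r z"
      using Cons.prems by auto
    then have "length z = length b"
      using Cons.prems length_span [of z "length b" rs] by simp
    then have "off_support b w = bw_add (off_support b r) (off_support b z)"
      using Cons.prems by (simp add: z off_support_add)
    then show ?thesis
      using Cons z by auto
  qed (use Cons in auto)
qed (simp add: off_support_zero)

text \<open>On the support of \<open>v\<close> exactly one of the two copies has a one; off the
  support the copies agree.\<close>

lemma hamming_weight_u_uv:
  "length u = length v \<Longrightarrow>
    hamming_weight (u @ bw_add u v) = hamming_weight v + 2 * hamming_weight (off_support v u)"
proof (induction u v rule: list_induct2)
  case (Cons x xs y ys)
  then show ?case by (cases y) (auto simp: hamming_weight_append)
qed simp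

fun deficit :: "bool list \<Rightarrow> nat \<Rightarrow> nat" where
  "deficit (True # b) (Suc d) = deficit b d"
| "deficit (False # b) d = deficit b d"
| "deficit [] d = d"
| "deficit b 0 = 0"

lemma deficit_eq: "deficit b d = d - hamming_weight b"
  by (induction b d rule: deficit.induct) auto

text \<open>The last argument is the weight required off the support. As \<open>heavy_coset\<close>
  asserts a strict bound, it is called with one less.\<close>

fun heavy_off_support :: "bool list \<Rightarrow> bool list \<Rightarrow> bool list list \<Rightarrow> nat \<Rightarrow> bool" where
  "heavy_off_support b a rs 0 = True"
| "heavy_off_support b a rs (Suc e) =
    heavy_coset (off_support b a) (map (off_support b) rs) e"

text \<open>Ones off the support count twice, so the requirement is half the deficit, rounded up by
  the inner \<open>Suc\<close>.\<close>

fun heavy_pairs ::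
  "nat \<Rightarrow> bool list list \<Rightarrow> (bool list \<times> bool list) list \<Rightarrow> bool list \<Rightarrow> bool list \<Rightarrow> bool"
where
  "heavy_pairs d rs [] a b = heavy_off_support b a rs (half (Suc (deficit b d)))"
| "heavy_pairs d rs ((x, y) # T) a b =
    (if heavy_pairs d rs T a b then heavy_pairs d rs T (bw_add a x) (bw_add b y) else False)"

text \<open>Again sorted by the first pair with coefficient one, which supplies the starting values
  of \<open>a\<close> and \<open>b\<close>.\<close>

fun heavy_nonzero_pairs ::
  "nat \<Rightarrow> bool list list \<Rightarrow> (bool list \<times> bool list) list \<Rightarrow> bool"
where
  "heavy_nonzero_pairs d rs [] = True"
| "heavy_nonzero_pairs d rs ((x, y) # T) =
    (if heavy_pairs d rs T x y then heavy_nonzero_pairs d rs T else False)"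

lemma heavy_off_support_sound:
  assumes "heavy_off_support b a rs (half (Suc (deficit b d)))"
    and "length a = length b" "\<forall>r\<in>set rs. length r = length b" "w \<in> span (length b) rs"
  shows "d \<le> hamming_weight (bw_add a w @ bw_add (bw_add a w) b)"
proof -
  have len: "length w = length b"
    using assms length_span by blast
  have "half (Suc (deficit b d)) \<le> hamming_weight (off_support b (bw_add a w))"
  proof (cases "half (Suc (deficit b d))")
    case (Suc e)
    have len': "length (off_support b a) = length (off_support b b)"
      using assms(2) by (rule length_off_support)
    have "heavy_coset (off_support b a) (map (off_support b) rs) e"
      using assms(1) unfolding Suc by (simp only: heavy_off_support.simps)
    moreover have "\<forall>r\<in>set (map (off_support b) rs). length r = length (off_support b a)"
      using assms(3) length_off_support len' by (metis imageE list.set_map)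
    moreover have "off_support b w \<in> span (length (off_support b a)) (map (off_support b) rs)"
      unfolding len' using assms(4,3) by (rule off_support_span)
    ultimately have "e < hamming_weight (bw_add (off_support b a) (off_support b w))"
      by (rule heavy_coset_sound)
    then show ?thesis
      unfolding off_support_add [OF assms(2) len] Suc by simp
  qed simp
  moreover have "hamming_weight (bw_add a w @ bw_add (bw_add a w) b) =
      hamming_weight b + 2 * hamming_weight (off_support b (bw_add a w))"
    using assms(2) len by (intro hamming_weight_u_uv) simp
  \<comment> \<open>Truncated subtraction also covers the case that \<open>b\<close> alone has
    weight at least \<open>d\<close>.\<close>
  ultimately show ?thesis
    unfolding half_eq deficit_eq by linarith
qed

lemma heavy_pairs_sound:
  assumes "heavy_pairs d rs T a b" "length xs = length T"
    and "length a = n" "length b = n" "\<forall>t\<in>set T. length (fst t) = n \<and> length (snd t) = n"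
    and "\<forall>r\<in>set rs. length r = n" "w \<in> span n rs"
  shows "d \<le> hamming_weight (bw_add (bw_add a (lin_comb n xs (map fst T))) w @
    bw_add (bw_add (bw_add a (lin_comb n xs (map fst T))) w)
      (bw_add b (lin_comb n xs (map snd T))))"
  using assms
proof (induction d rs T a b arbitrary: xs rule: heavy_pairs.induct)
  case (1 d rs a b)
  then have "d \<le> hamming_weight (bw_add a w @ bw_add (bw_add a w) b)"
    using heavy_off_support_sound by simp
  moreover have "xs = []" "bw_add a (bw_zero n) = a" "bw_add b (bw_zero n) = b"
    using "1.prems"(2-4) by simp_all
  ultimately show ?case
    by (simp only: list.map lin_comb.simps)
next
  case (2 d rs x y T a b)
  obtain c ys where xs: "xs = c # ys"
    using "2.prems"(2) by (cases xs) auto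
  have heavy: "heavy_pairs d rs T a b" "heavy_pairs d rs T (bw_add a x) (bw_add b y)"
    using "2.prems"(1) by (simp_all split: if_splits)
  have len: "length ys = length T" "length (bw_add a x) = n" "length (bw_add b y) = n"
    "\<forall>t\<in>set T. length (fst t) = n \<and> length (snd t) = n"
    using "2.prems" by (simp_all add: xs)
  show ?case
  proof (cases c)
    case True
    show ?thesis
      using "2.IH"(2) [OF heavy(1) heavy(2) len "2.prems"(6,7)]
      by (simp only: xs True list.map fst_conv snd_conv lin_comb.simps if_True bw_add_assoc)
  next
    case False
    show ?thesis
      using "2.IH"(1) [OF heavy(1) len(1) "2.prems"(3,4) len(4) "2.prems"(6,7)]
      by (simp only: xs False list.map fst_conv snd_conv lin_comb.simps if_False)
  qed
qed

lemma heavy_nonzero_pairs_sound: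
  assumes "heavy_nonzero_pairs d rs T" "length xs = length T" "True \<in> set xs"
    and "\<forall>t\<in>set T. length (fst t) = n \<and> length (snd t) = n"
    and "\<forall>r\<in>set rs. length r = n" "w \<in> span n rs"
  shows "d \<le> hamming_weight (bw_add (lin_comb n xs (map fst T)) w @
    bw_add (bw_add (lin_comb n xs (map fst T)) w) (lin_comb n xs (map snd T)))"
  using assms
proof (induction T arbitrary: xs)
  case (Cons t T)
  obtain x y where t: "t = (x, y)"
    by (cases t)
  obtain c ys where xs: "xs = c # ys"
    using Cons.prems(2) by (cases xs) auto
  show ?case
  proof (cases c)
    case True
    then show ?thesis
      using heavy_pairs_sound [of d rs T x y ys n w] Cons.prems
      by (simp add: t xs split: if_splits)
  next
    case False
    then show ?thesis
      using Cons by (simp add: t xs split: if_splits)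
  qed
qed simp

section \<open>The doubling construction\<close>

text \<open>A pair \<open>(a, b)\<close> stands for the row \<open>(a | a + b)\<close>.\<close>

definition plotkin ::
  "(bool list \<times> bool list) list \<Rightarrow> bool list list \<Rightarrow> bool list list"
where
  "plotkin T rs = map (\<lambda>(a, b). a @ bw_add a b) T @ map (\<lambda>r. r @ r) rs"

lemma length_plotkin:
  assumes "\<forall>t\<in>set T. length (fst t) = n \<and> length (snd t) = n" "\<forall>r\<in>set rs. length r = n"
  shows "\<forall>r\<in>set (plotkin T rs). length r = n + n"
  using assms by (auto simp: plotkin_def)

lemma lin_comb_plotkin_left:
  assumes "length xs = length T" "\<forall>t\<in>set T. length (fst t) = n \<and> length (snd t) = n"
  shows "lin_comb (n + n) xs (map (\<lambda>(a, b). a @ bw_add a b) T) =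
    lin_comb n xs (map fst T) @ bw_add (lin_comb n xs (map fst T)) (lin_comb n xs (map snd T))"
  using assms
proof (induction xs T rule: list_induct2)
  case (Cons c xs t T)
  obtain a b where t: "t = (a, b)"
    by (cases t)
  have "length (lin_comb n xs (map fst T)) = n" "length (lin_comb n xs (map snd T)) = n"
    using Cons.prems by (simp_all add: length_lin_comb)
  then show ?case
    using Cons by (simp add: t bw_add_append) (simp add: bw_add_ac)
qed (simp add: bw_zero_add)

lemma lin_comb_double:
  assumes "length xs = length rs" "\<forall>r\<in>set rs. length r = n"
  shows "lin_comb (n + n) xs (map (\<lambda>r. r @ r) rs) = lin_comb n xs rs @ lin_comb n xs rs"
  using assms
  by (induction xs rs rule: list_induct2) (auto simp: bw_zero_add bw_add_append)

text \<open>If some pair occurs in the combination, the search gives the bound; otherwise the word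
  is (w | w), with twice the weight of a nonzero combination of \<open>rs\<close>.\<close>

lemma plotkin_min_weight:
  assumes T: "\<forall>t\<in>set T. length (fst t) = n \<and> length (snd t) = n"
    and rs: "\<forall>r\<in>set rs. length r = n"
    and heavy: "heavy_nonzero_pairs (2 * d) rs T" and d: "min_weight n d rs"
  shows "min_weight (n + n) (2 * d) (plotkin T rs)"
  unfolding min_weight_def
proof (intro allI impI, elim conjE)
  fix cs assume cs: "length cs = length (plotkin T rs)" "True \<in> set cs"
  define xs ys where "xs = take (length T) cs" and "ys = drop (length T) cs"
  have cs_eq: "cs = xs @ ys" and len: "length xs = length T" "length ys = length rs"
    using cs by (simp_all add: xs_def ys_def plotkin_def)
  define a b w where "a = lin_comb n xs (map fst T)" and "b = lin_comb n xs (map snd T)"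
    and "w = lin_comb n ys rs"
  have lens: "length a = n" "length b = n" "length w = n"
    unfolding a_def b_def w_def using T rs by (simp_all add: length_lin_comb)
  have "lin_comb (n + n) cs (plotkin T rs) = bw_add (a @ bw_add a b) (w @ w)"
    unfolding plotkin_def cs_eq using len T rs
    by (subst lin_comb_append)
      (auto simp: lin_comb_plotkin_left lin_comb_double a_def b_def w_def)
  then have word: "lin_comb (n + n) cs (plotkin T rs) = bw_add a w @ bw_add (bw_add a w) b"
    using lens by (simp add: bw_add_append bw_add_ac)
  show "2 * d \<le> hamming_weight (lin_comb (n + n) cs (plotkin T rs))"
  proof (cases "True \<in> set xs")
    case True
    then show ?thesis
      unfolding word a_def b_def w_def
      using heavy_nonzero_pairs_sound [OF heavy len(1) _ T rs] lin_comb_in_span len by blast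
  next
    case False
    then have "a = bw_zero n" "b = bw_zero n"
      by (simp_all add: a_def b_def lin_comb_zero)
    then have "hamming_weight (lin_comb (n + n) cs (plotkin T rs)) = 2 * hamming_weight w"
      using word lens by (simp add: hamming_weight_append)
    moreover have "d \<le> hamming_weight w"
      using d cs cs_eq False len by (auto simp: min_weight_def w_def)
    ultimately show ?thesis by simp
  qed
qed

section \<open>Generator rows\<close>

abbreviation (input) I where "I \<equiv> True"
abbreviation (input) Z where "Z \<equiv> False"

text \<open>Systematic form on the first 11 coordinates.\<close>

definition code27 :: "bool list list" where
  "code27 = [
   [I,Z,Z,Z,Z,Z,Z,Z,Z,Z,Z,Z,I,I,I,Z,I,I,Z,Z,I,I,I,Z,I,I,Z],
   [Z,I,Z,Z,Z,Z,Z,Z,Z,Z,Z,I,Z,I,Z,I,I,I,Z,I,I,I,Z,I,Z,I,I],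
   [Z,Z,I,Z,Z,Z,Z,Z,Z,Z,Z,Z,I,I,I,Z,Z,I,I,I,Z,Z,I,I,I,I,Z],
   [Z,Z,Z,I,Z,Z,Z,Z,Z,Z,Z,I,I,I,I,Z,I,Z,I,I,I,I,Z,Z,I,Z,Z],
   [Z,Z,Z,Z,I,Z,Z,Z,Z,Z,Z,I,I,Z,Z,Z,I,Z,Z,I,I,I,I,I,I,Z,I],
   [Z,Z,Z,Z,Z,I,Z,Z,Z,Z,Z,Z,I,Z,I,Z,I,Z,I,Z,Z,I,Z,I,I,I,Z],
   [Z,Z,Z,Z,Z,Z,I,Z,Z,Z,Z,I,I,Z,Z,I,I,Z,I,Z,Z,I,I,I,Z,Z,Z],
   [Z,Z,Z,Z,Z,Z,Z,I,Z,Z,Z,I,I,I,I,I,Z,I,Z,Z,I,I,I,Z,Z,Z,I],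
   [Z,Z,Z,Z,Z,Z,Z,Z,I,Z,Z,I,I,Z,I,Z,I,I,Z,Z,Z,Z,Z,Z,Z,I,I],
   [Z,Z,Z,Z,Z,Z,Z,Z,Z,I,Z,I,Z,Z,I,I,I,I,Z,Z,I,Z,Z,I,Z,Z,Z],
   [Z,Z,Z,Z,Z,Z,Z,Z,Z,Z,I,Z,I,Z,Z,I,I,I,I,I,I,Z,Z,I,Z,Z,I]]"

definition pairs27 :: "(bool list \<times> bool list) list" where
  "pairs27 = [
   ([Z,Z,Z,Z,Z,Z,Z,Z,Z,Z,Z,Z,I,I,Z,I,I,I,I,I,Z,Z,I,Z,Z,Z,Z],
    [I,Z,Z,Z,Z,Z,Z,I,Z,I,I,Z,I,Z,I,I,I,Z,I,I,Z,Z,Z,Z,I,I,Z]),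
   ([Z,Z,Z,Z,Z,Z,Z,Z,Z,Z,Z,Z,I,Z,I,Z,I,I,Z,I,I,Z,Z,Z,I,I,Z],
    [Z,I,Z,Z,Z,I,Z,I,I,Z,Z,I,I,Z,I,Z,I,I,I,I,Z,I,I,Z,I,I,I]),
   ([Z,Z,Z,Z,Z,Z,Z,Z,Z,Z,Z,Z,I,Z,Z,Z,I,Z,Z,Z,I,I,I,Z,I,Z,I],
    [Z,Z,I,Z,Z,I,Z,Z,I,I,Z,Z,I,I,Z,I,I,I,Z,I,I,I,I,I,Z,I,I]),
   ([Z,Z,Z,Z,Z,Z,Z,Z,Z,Z,Z,I,I,I,I,I,Z,I,Z,I,Z,I,Z,I,Z,Z,I],
    [Z,Z,Z,I,Z,I,Z,Z,I,I,I,I,Z,I,Z,Z,I,I,I,Z,I,Z,Z,I,Z,Z,Z]),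
   ([Z,Z,Z,Z,Z,Z,Z,Z,Z,Z,Z,I,Z,Z,Z,Z,Z,Z,Z,Z,I,I,I,Z,Z,I,I],
    [Z,Z,Z,Z,I,I,Z,Z,Z,Z,I,I,I,Z,I,I,I,I,Z,Z,Z,Z,I,I,Z,I,Z]),
   ([Z,Z,Z,Z,Z,Z,Z,Z,Z,Z,Z,Z,I,I,I,I,I,Z,I,I,Z,Z,Z,I,I,Z,Z],
    [Z,Z,Z,Z,Z,Z,I,I,I,Z,I,I,Z,I,Z,I,I,I,Z,I,Z,Z,Z,Z,Z,I,I])]"

text \<open>The first three pairs get names so that the separate evaluations below can refer to
  their sums.\<close>

definition u1 :: "bool list" where
  "u1 = [Z,Z,Z,Z,Z,Z,Z,Z,Z,Z,Z,Z,Z,Z,Z,Z,Z,I,I,Z,I,Z,Z,Z,Z,Z,Z,I,Z,I,I,Z,Z,I,I,Z,I,Z,Z,Z,I,I,Z,Z,I,I,Z,I,I,Z,I,I,Z,I]"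

definition v1 :: "bool list" where
  "v1 = [I,Z,Z,Z,Z,Z,Z,Z,Z,Z,Z,Z,Z,Z,I,I,I,I,Z,Z,Z,Z,I,I,I,I,I,I,I,I,I,I,Z,Z,I,I,Z,Z,I,I,Z,I,I,I,I,Z,Z,Z,Z,Z,Z,Z,Z,I]"

definition u2 :: "bool list" where
  "u2 = [Z,Z,Z,Z,Z,Z,Z,Z,Z,Z,Z,Z,Z,Z,Z,I,Z,Z,Z,Z,I,I,I,Z,Z,Z,I,I,I,I,I,I,I,Z,I,I,Z,Z,I,I,I,I,Z,Z,Z,I,I,Z,I,Z,Z,I,Z,I]"

definition v2 :: "bool list" where
  "v2 = [Z,I,Z,Z,Z,Z,Z,Z,Z,Z,Z,Z,I,Z,I,Z,I,Z,Z,Z,I,Z,Z,Z,Z,I,Z,Z,I,Z,I,Z,I,Z,Z,I,I,I,I,I,I,I,Z,Z,I,I,Z,Z,Z,Z,I,Z,I,Z]"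

definition u3 :: "bool list" where
  "u3 = [Z,Z,Z,Z,Z,Z,Z,Z,Z,Z,Z,Z,Z,Z,Z,Z,Z,Z,Z,Z,I,I,Z,I,Z,Z,I,I,I,I,Z,I,Z,Z,Z,Z,Z,I,Z,I,Z,Z,Z,Z,Z,Z,I,I,I,Z,I,I,Z,I]"

definition v3 :: "bool list" where
  "v3 = [Z,Z,I,Z,Z,Z,Z,Z,Z,Z,Z,Z,Z,Z,Z,I,Z,Z,I,I,I,I,Z,I,Z,I,I,I,I,Z,I,I,Z,I,I,Z,I,Z,Z,Z,I,I,I,Z,I,Z,I,I,I,I,Z,Z,Z,Z]"

definition pairs54_tail :: "(bool list \<times> bool list) list" where
  "pairs54_tail = [
   ([Z,Z,Z,Z,Z,Z,Z,Z,Z,Z,Z,Z,Z,Z,Z,I,Z,I,I,Z,Z,I,I,Z,I,I,Z,I,Z,Z,Z,I,Z,Z,I,I,Z,I,I,I,I,I,Z,Z,Z,I,Z,I,I,I,I,Z,Z,Z],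
    [Z,Z,Z,I,Z,Z,Z,Z,Z,Z,Z,Z,I,Z,I,I,I,I,Z,I,I,Z,I,I,I,Z,I,Z,I,Z,I,I,Z,I,Z,Z,Z,Z,I,I,I,I,I,Z,Z,I,I,I,I,I,Z,Z,I,I]),
   ([Z,Z,Z,Z,Z,Z,Z,Z,Z,Z,Z,Z,Z,Z,Z,I,Z,Z,Z,Z,Z,I,I,Z,Z,Z,I,Z,I,Z,Z,I,Z,Z,I,I,Z,Z,Z,I,I,Z,Z,I,Z,I,I,I,Z,Z,Z,Z,I,Z],
    [Z,Z,Z,Z,I,Z,Z,Z,Z,Z,Z,Z,I,Z,Z,Z,Z,I,I,I,I,Z,I,I,Z,Z,Z,Z,Z,Z,I,I,I,I,I,Z,I,Z,Z,I,Z,Z,I,Z,I,Z,Z,Z,Z,I,Z,Z,I,I]),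
   ([Z,Z,Z,Z,Z,Z,Z,Z,Z,Z,Z,Z,Z,Z,Z,I,Z,I,Z,Z,Z,I,Z,Z,Z,Z,I,Z,I,Z,I,I,I,Z,I,Z,I,Z,I,I,I,I,I,Z,I,Z,Z,Z,I,I,Z,Z,Z,I],
    [Z,Z,Z,Z,Z,I,Z,Z,Z,Z,Z,Z,Z,Z,Z,Z,Z,I,I,Z,I,Z,Z,Z,I,I,I,I,Z,I,Z,Z,Z,I,Z,Z,Z,Z,I,Z,Z,I,I,I,I,Z,I,Z,I,I,I,Z,Z,I]),
   ([Z,Z,Z,Z,Z,Z,Z,Z,Z,Z,Z,Z,Z,Z,Z,Z,Z,Z,I,Z,I,Z,Z,Z,I,I,I,I,I,Z,I,I,I,I,I,Z,I,Z,Z,I,I,I,I,Z,I,I,I,Z,Z,I,Z,I,Z,Z],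
    [Z,Z,Z,Z,Z,Z,I,Z,Z,Z,Z,Z,I,Z,Z,I,Z,I,Z,I,Z,I,I,Z,Z,I,Z,I,I,I,I,Z,I,I,Z,I,I,Z,Z,Z,Z,Z,I,Z,Z,I,Z,Z,I,I,Z,Z,Z,Z]),
   ([Z,Z,Z,Z,Z,Z,Z,Z,Z,Z,Z,Z,Z,Z,Z,Z,Z,Z,Z,Z,Z,I,Z,Z,Z,I,Z,I,Z,I,Z,Z,I,I,Z,Z,Z,Z,Z,Z,Z,Z,Z,Z,Z,Z,Z,Z,Z,Z,I,Z,I,Z],
    [Z,Z,Z,Z,Z,Z,Z,I,Z,I,Z,Z,Z,Z,I,I,I,I,Z,I,I,I,Z,Z,Z,I,I,Z,Z,Z,I,I,Z,Z,I,I,Z,Z,Z,I,I,Z,Z,I,I,I,I,Z,I,I,Z,Z,Z,I]),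
   ([Z,Z,Z,Z,Z,Z,Z,Z,Z,Z,Z,Z,Z,Z,Z,I,Z,I,Z,Z,Z,Z,Z,I,Z,Z,Z,Z,Z,Z,I,Z,Z,I,Z,I,I,I,I,I,Z,I,Z,I,Z,Z,Z,I,Z,I,Z,I,I,Z],
    [Z,Z,Z,Z,Z,Z,Z,Z,I,I,Z,Z,I,Z,I,I,I,Z,I,I,Z,I,Z,I,I,I,Z,Z,I,I,I,I,Z,I,Z,I,I,I,Z,Z,I,I,Z,Z,I,I,Z,Z,I,I,Z,Z,I,I]),
   ([Z,Z,Z,Z,Z,Z,Z,Z,Z,Z,Z,Z,Z,Z,Z,Z,Z,I,Z,Z,Z,Z,Z,I,I,Z,I,I,I,Z,I,I,Z,I,Z,Z,Z,I,I,I,I,I,Z,Z,I,Z,Z,Z,Z,I,I,I,I,Z],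
    [Z,Z,Z,Z,Z,Z,Z,Z,Z,Z,I,Z,I,Z,I,I,I,Z,I,Z,I,I,I,I,Z,I,Z,Z,I,I,Z,Z,Z,Z,I,Z,I,I,I,I,I,Z,Z,I,Z,Z,Z,Z,I,I,Z,I,I,Z]),
   ([Z,Z,Z,Z,Z,Z,Z,Z,Z,Z,Z,Z,Z,Z,Z,Z,Z,Z,Z,Z,I,I,I,I,I,Z,Z,I,Z,Z,I,I,Z,Z,Z,I,I,I,Z,Z,I,Z,I,I,I,Z,I,I,I,Z,Z,I,I,Z],
    [Z,Z,Z,Z,Z,Z,Z,Z,Z,Z,Z,I,I,Z,Z,Z,Z,I,I,I,I,I,I,I,I,I,I,I,I,Z,I,Z,Z,Z,Z,Z,Z,Z,I,I,I,Z,I,I,I,Z,I,Z,Z,Z,Z,I,I,Z]),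
   ([Z,Z,Z,Z,Z,Z,Z,Z,Z,Z,Z,Z,Z,Z,Z,Z,Z,Z,I,Z,I,Z,Z,I,I,I,I,I,Z,I,Z,Z,I,Z,I,I,Z,Z,I,I,I,Z,Z,I,I,Z,I,I,Z,Z,I,Z,Z,Z],
    [Z,Z,Z,Z,Z,Z,Z,Z,Z,Z,Z,Z,Z,I,I,I,Z,Z,I,I,I,I,I,I,Z,Z,I,Z,Z,I,Z,Z,I,I,I,Z,I,I,I,I,I,I,I,Z,Z,I,I,Z,Z,Z,Z,Z,Z,I])]"

definition pairs54 :: "(bool list \<times> bool list) list" where
  "pairs54 = (u1, v1) # (u2, v2) # (u3, v3) # pairs54_tail"

definition code54 :: "bool list list" where
  "code54 = plotkin pairs27 code27"

definition code108 :: "bool list list" where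
  "code108 = plotkin pairs54 code54"

section \<open>Minimum weights of the three codes\<close>

lemma code27_min_weight: "min_weight 27 8 code27"
proof -
  have "heavy_code 7 code27"
    by code_simp
  moreover have "\<forall>r\<in>set code27. length r = 27"
    by (simp add: code27_def)
  ultimately have "min_weight 27 (Suc 7) code27"
    by (rule heavy_code_sound)
  then show ?thesis by simp
qed

lemma length_code54: "\<forall>r\<in>set code54. length r = 54"
  unfolding code54_def using length_plotkin [of pairs27 27 code27]
  by (simp add: code27_def pairs27_def)

lemma code54_min_weight: "min_weight 54 16 code54"
proof -
  \<comment> \<open>Doubling turns the bound 8 for \<open>code27\<close> into 16, so the same 16 is
    asked of words involving a pair.\<close>
  have "heavy_nonzero_pairs (2 * 8) code27 pairs27"
    by code_simp
  then have "min_weight (27 + 27) (2 * 8) code54"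
    unfolding code54_def using code27_min_weight
    by (intro plotkin_min_weight) (simp_all add: code27_def pairs27_def)
  then show ?thesis by simp
qed

text \<open>The 4095 nonzero choices of \<open>b\<close> are split by their coefficients at the first three
  pairs, so that the evaluations are of moderate size and can run in parallel.\<close>

lemma heavy_pairs54_3:
  "heavy_pairs 32 code54 pairs54_tail u3 v3"
  by code_simp

lemma heavy_pairs54_2:
  "heavy_pairs 32 code54 pairs54_tail u2 v2"
  by code_simp

lemma heavy_pairs54_23:
  "heavy_pairs 32 code54 pairs54_tail (bw_add u2 u3) (bw_add v2 v3)"
  by code_simp

lemma heavy_pairs54_1:
  "heavy_pairs 32 code54 pairs54_tail u1 v1"
  by code_simp

lemma heavy_pairs54_13:
  "heavy_pairs 32 code54 pairs54_tail (bw_add u1 u3) (bw_add v1 v3)"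
  by code_simp

lemma heavy_pairs54_12:
  "heavy_pairs 32 code54 pairs54_tail (bw_add u1 u2) (bw_add v1 v2)"
  by code_simp

lemma heavy_pairs54_123:
  "heavy_pairs 32 code54 pairs54_tail (bw_add (bw_add u1 u2) u3) (bw_add (bw_add v1 v2) v3)"
  by code_simp

text \<open>The remaining case, in which the coefficients at the first three pairs all
  vanish.\<close>

lemma heavy_pairs54_tail: "heavy_nonzero_pairs 32 code54 pairs54_tail"
  by code_simp

lemma length_pairs54: "\<forall>t\<in>set pairs54. length (fst t) = 54 \<and> length (snd t) = 54"
  by (simp add: pairs54_def pairs54_tail_def u1_def v1_def u2_def v2_def u3_def v3_def)

lemma length_code108: "\<forall>r\<in>set code108. length r = 108"
  unfolding code108_def using length_plotkin [OF length_pairs54 length_code54] by simp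

lemma code108_min_weight: "min_weight 108 32 code108"
proof -
  have "heavy_nonzero_pairs 32 code54 pairs54"
    \<comment> \<open>Unfolding along the three named pairs leaves their seven nonzero sums and the
      tail.\<close>
    by (simp add: pairs54_def heavy_pairs54_3 heavy_pairs54_2 heavy_pairs54_23 heavy_pairs54_1
      heavy_pairs54_13 heavy_pairs54_12 heavy_pairs54_123
      heavy_pairs54_tail)
  then have "heavy_nonzero_pairs (2 * 16) code54 pairs54"
    by simp
  then have "min_weight (54 + 54) (2 * 16) code108"
    unfolding code108_def
    using length_pairs54 length_code54 code54_min_weight by (intro plotkin_min_weight)
  then show ?thesis by simp
qed

theorem theorem5p3:
  shows "\<exists>C. binary_linear_code 108 C \<and> code_dim 108 C 29 \<and> min_distance C 32"
proof (intro exI conjI)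
  show "binary_linear_code 108 (span 108 code108)"
    using length_code108 by (rule span_binary_linear_code)
  \<comment> \<open>There are 12 pairs of length 54, 6 pairs of length 27 and 11 rows of
    \<open>code27\<close>.\<close>
  have "length code108 = 29"
    by (simp add: code108_def code54_def plotkin_def code27_def pairs27_def pairs54_def
      pairs54_tail_def)
  then show "code_dim 108 (span 108 code108) 29"
    using span_code_dim [OF code108_min_weight _ length_code108] by simp
  \<comment> \<open>This row has weight 8; doubling it twice gives a word of the code of weight
    32.\<close>
  define w where "w = code27 ! 8"
  have "w @ w \<in> set code54"
    by (auto simp: code54_def plotkin_def code27_def w_def)
  then have "(w @ w) @ (w @ w) \<in> span 108 code108"
    using set_subset_span [OF length_code108] by (auto simp: code108_def plotkin_def)
  moreover have "hamming_weight ((w @ w) @ (w @ w)) = 32"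
    by (simp add: hamming_weight_append w_def code27_def)
  ultimately show "min_distance (span 108 code108) 32"
    using span_min_distance [OF code108_min_weight _ length_code108] by simp
qed

end
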